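(* Let $(\bar{M},\bar{g},\bar{\nabla},\bar{\nabla}^{*})$ be an indefinite statistical manifold and let $(M,g)$ be a lightlike submanifold of $\bar M$ with induced connections $\nabla$ and $\nabla^{*}$, such that $\nabla^{*}$ is a dual connection of $\nabla$ with respect to the induced metric $g$. Then $(M,g,\nabla)$ is a lightlike statistical submanifold of $\bar{M}$ if and only if $(M,g,\nabla^{*})$ is a lightlike statistical submanifold of $\bar{M}$.
   Context: All objects are smooth; $\Gamma(E)$ denotes sections of $E$. An indefinite statistical manifold $(\bar M,\bar g,\bar\nabla,\bar\nabla^* )$ is an $(m+n)$-dimensional manifold ($m,n\ge 1$) with a semi-Riemannian metric $\bar g$ of constant index $q$, $1\le q\le m+n-1$, a torsion-free affine connection $\bar\nabla$ with $(\bar\nabla_X\bar g)(Y,Z)=(\bar\nabla_Y\bar g)(X,Z)$, and its torsion-free dual connection $\bar\nabla^*$, determined by $X\bar g(Y,Z)=\bar g(\bar\nabla_XY,Z)+\bar g(Y,\bar\nabla^*_XZ)$, for all vector fields $X,Y,Z$ on $\bar M$. A lightlike submanifold $(M,g)$ is an $m$-dimensional submanifold with degenerate induced (symmetric bilinear) metric $g$ such that $Rad(TM)=TM\cap TM^\perp$ is a smooth distribution of rank $r>0$. Fix a screen distribution $S(TM)$, a non-degenerate complement with $TM=Rad(TM)\perp S(TM)$; a non-degenerate complement $S(TM^\perp)$ of $Rad(TM)$ in $TM^\perp$; and a lightlike transversal bundle $ltr(TM)$ of rank $r$, having local frames $\{N_i\}$ with $\bar g(N_i,\xi_j)=\delta_{ij}$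 for a local frame $\{\xi_j\}$ of $Rad(TM)$, $\bar g(N_i,N_j)=0$, and $ltr(TM)$ orthogonal to $S(TM)$ and $S(TM^\perp)$. Put $tr(TM)=ltr(TM)\perp S(TM^\perp)$, so $T\bar M|_M=TM\oplus tr(TM)$. For $X,Y\in\Gamma(TM)$ the induced connections $\nabla,\nabla^*$ on $M$ (both torsion-free) are defined by: $\nabla_XY$ and $\nabla^*_XY$ are the $TM$-components of $\bar\nabla_XY$ and $\bar\nabla^*_XY$ in the decomposition $T\bar M|_M=TM\oplus tr(TM)$. $(M,g,\nabla)$ is a lightlike statistical submanifold if $(\nabla_Xg)(Y,Z)=(\nabla_Yg)(X,Z)$ for all $X,Y,Z\in\Gamma(TM)$; similarly for $(M,g,\nabla^* )$ with $\nabla^*$ in place of $\nabla$. $\nabla^*$ is a dual connection of $\nabla$ with respect to $g$ if $Xg(Y,Z)=g(\nabla_XY,Z)+g(Y,\nabla^*_XZ)$ for all $X,Y,Z\in\Gamma(TM)$. *)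

theory Defs
  imports "HOL-Analysis.Analysis" "HOL-Library.Function_Algebras"
begin

text \<open>
  Real-valued functions on a set form a real vector space under the pointwise operations. Tangent
  vectors are functionals on smooth functions, so this instance makes
  \<^const>\<open>subspace\<close>, \<^const>\<open>span\<close>, \<^const>\<open>independent\<close> and \<^const>\<open>dim\<close> available for them.
\<close>

instantiation "fun" :: (type, real_vector) real_vector
begin

definition scaleR_fun :: "real \<Rightarrow> ('a \<Rightarrow> 'b) \<Rightarrow> 'a \<Rightarrow> 'b" where
  "scaleR_fun c f = (\<lambda>x. c *\<^sub>R f x)"

instance
  by standard (simp_all add: scaleR_fun_def fun_eq_iff scaleR_add_right scaleR_add_left)

end


section \<open>Smooth manifolds\<close>

text \<open>\<open>C\<^sup>k\<close> maps on an open subset of a Euclidean space.\<close>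

fun Ck_on :: "nat \<Rightarrow> 'c::euclidean_space set \<Rightarrow> ('c \<Rightarrow> 'v::real_normed_vector) \<Rightarrow> bool" where
  "Ck_on 0 S f \<longleftrightarrow> continuous_on S f"
| "Ck_on (Suc k) S f \<longleftrightarrow>
     (\<forall>x\<in>S. f differentiable (at x)) \<and> (\<forall>v. Ck_on k S (\<lambda>x. frechet_derivative f (at x) v))"

definition smooth_on :: "'c::euclidean_space set \<Rightarrow> ('c \<Rightarrow> 'v::real_normed_vector) \<Rightarrow> bool" where
  "smooth_on S f \<longleftrightarrow> (\<forall>k. Ck_on k S f)"

text \<open>
  The points of a manifold are the elements of a (Hausdorff, second countable) type. A smooth
  structure of dimension \<open>DIM('e)\<close> is given by an atlas, which need not be maximal. Of a chart
  \<open>(U, \<phi>)\<close> only the values of \<open>\<phi>\<close> on \<open>U\<close> matter; its inverse is \<open>inv_into U \<phi>\<close>.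
\<close>

type_synonym ('a, 'e) chart = "'a set \<times> ('a \<Rightarrow> 'e)"

definition is_chart :: "('a::topological_space, 'e::euclidean_space) chart \<Rightarrow> bool" where
  "is_chart = (\<lambda>(U, \<phi>). open U \<and> open (\<phi> ` U) \<and> homeomorphism U (\<phi> ` U) \<phi> (inv_into U \<phi>))"

definition smooth_manifold ::
  "('a::{t2_space,second_countable_topology}, 'e::euclidean_space) chart set \<Rightarrow> bool" where
  "smooth_manifold A \<longleftrightarrow>
     (\<forall>c\<in>A. is_chart c) \<and>
     (\<Union>(U, \<phi>)\<in>A. U) = UNIV \<and>
     (\<forall>(U, \<phi>)\<in>A. \<forall>(V, \<psi>)\<in>A. smooth_on (\<phi> ` (U \<inter> V)) (\<psi> \<circ> inv_into U \<phi>))"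

definition smooth_fun_on ::
  "('a::topological_space, 'e::euclidean_space) chart set \<Rightarrow> 'a set \<Rightarrow> ('a \<Rightarrow> real) \<Rightarrow> bool" where
  "smooth_fun_on A W f \<longleftrightarrow> (\<forall>(U, \<phi>)\<in>A. smooth_on (\<phi> ` (U \<inter> W)) (f \<circ> inv_into U \<phi>))"

definition smooth_functions ::
  "('a::topological_space, 'e::euclidean_space) chart set \<Rightarrow> ('a \<Rightarrow> real) set" where
  "smooth_functions A = {f. smooth_fun_on A UNIV f}"

definition smooth_map ::
  "('b::topological_space, 'd::euclidean_space) chart set \<Rightarrow>
   ('a::topological_space, 'e::euclidean_space) chart set \<Rightarrow> ('b \<Rightarrow> 'a) \<Rightarrow> bool" where
  "smooth_map B A F \<longleftrightarrow>
     continuous_on UNIV F \<and>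
     (\<forall>(U, \<phi>)\<in>B. \<forall>(V, \<psi>)\<in>A. smooth_on (\<phi> ` (U \<inter> F -` V)) (\<psi> \<circ> F \<circ> inv_into U \<phi>))"


section \<open>Tangent vectors and vector fields\<close>

text \<open>
  A tangent vector at \<open>p\<close> is a derivation at \<open>p\<close> of the algebra of smooth functions. The
  value 0 on functions that are not smooth is a convention which makes two tangent vectors equal
  as soon as they agree on smooth functions.
\<close>

type_synonym 'a tvec = "('a \<Rightarrow> real) \<Rightarrow> real"

definition tangent_space ::
  "('a::topological_space, 'e::euclidean_space) chart set \<Rightarrow> 'a \<Rightarrow> 'a tvec set" where
  "tangent_space A p =
     {v. (\<forall>f\<in>smooth_functions A. \<forall>h\<in>smooth_functions A.
            v (\<lambda>x. f x + h x) = v f + v h \<and>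
            v (\<lambda>x. f x * h x) = f p * v h + h p * v f) \<and>
         (\<forall>c. \<forall>f\<in>smooth_functions A. v (\<lambda>x. c * f x) = c * v f) \<and>
         (\<forall>f. f \<notin> smooth_functions A \<longrightarrow> v f = 0)}"

text \<open>Differential of a smooth map \<open>F\<close> into the manifold with atlas \<open>A\<close>.\<close>

definition push_forward ::
  "('a::topological_space, 'e::euclidean_space) chart set \<Rightarrow> ('b \<Rightarrow> 'a) \<Rightarrow> 'b tvec \<Rightarrow> 'a tvec" where
  "push_forward A F v = (\<lambda>f. if f \<in> smooth_functions A then v (f \<circ> F) else 0)"

definition vector_fields ::
  "('a::topological_space, 'e::euclidean_space) chart set \<Rightarrow> ('a \<Rightarrow> 'a tvec) set" where
  "vector_fields A =
     {X. (\<forall>p. X p \<in> tangent_space A p) \<and>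
         (\<forall>f\<in>smooth_functions A. (\<lambda>p. X p f) \<in> smooth_functions A)}"

definition lie_bracket :: "('a \<Rightarrow> 'a tvec) \<Rightarrow> ('a \<Rightarrow> 'a tvec) \<Rightarrow> 'a \<Rightarrow> 'a tvec" where
  "lie_bracket X Y = (\<lambda>p f. X p (\<lambda>x. Y x f) - Y p (\<lambda>x. X x f))"


section \<open>Connections and metrics\<close>

text \<open>
  Connections and metrics are total functions; they are only constrained on vector fields and on
  tangent vectors, respectively.
\<close>

type_synonym 'a connection = "('a \<Rightarrow> 'a tvec) \<Rightarrow> ('a \<Rightarrow> 'a tvec) \<Rightarrow> 'a \<Rightarrow> 'a tvec"
type_synonym 'a bilinear_field = "'a \<Rightarrow> 'a tvec \<Rightarrow> 'a tvec \<Rightarrow> real"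

definition affine_connection ::
  "('a::topological_space, 'e::euclidean_space) chart set \<Rightarrow> 'a connection \<Rightarrow> bool" where
  "affine_connection A D \<longleftrightarrow>
     (\<forall>X\<in>vector_fields A. \<forall>Y\<in>vector_fields A. D X Y \<in> vector_fields A) \<and>
     (\<forall>X\<in>vector_fields A. \<forall>Y\<in>vector_fields A. \<forall>Z\<in>vector_fields A.
        D (X + Y) Z = D X Z + D Y Z \<and> D X (Y + Z) = D X Y + D X Z) \<and>
     (\<forall>f\<in>smooth_functions A. \<forall>X\<in>vector_fields A. \<forall>Y\<in>vector_fields A.
        D (\<lambda>p. f p *\<^sub>R X p) Y = (\<lambda>p. f p *\<^sub>R D X Y p) \<and>
        D X (\<lambda>p. f p *\<^sub>R Y p) = (\<lambda>p. X p f *\<^sub>R Y p + f p *\<^sub>R D X Y p))"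

definition torsion_free ::
  "('a::topological_space, 'e::euclidean_space) chart set \<Rightarrow> 'a connection \<Rightarrow> bool" where
  "torsion_free A D \<longleftrightarrow>
     (\<forall>X\<in>vector_fields A. \<forall>Y\<in>vector_fields A. D X Y - D Y X = lie_bracket X Y)"

definition cov_deriv_metric ::
  "'a bilinear_field \<Rightarrow> 'a connection \<Rightarrow>
   ('a \<Rightarrow> 'a tvec) \<Rightarrow> ('a \<Rightarrow> 'a tvec) \<Rightarrow> ('a \<Rightarrow> 'a tvec) \<Rightarrow> 'a \<Rightarrow> real" where
  "cov_deriv_metric g D X Y Z p =
     X p (\<lambda>x. g x (Y x) (Z x)) - g p (D X Y p) (Z p) - g p (Y p) (D X Z p)"

definition codazzi ::
  "('a::topological_space, 'e::euclidean_space) chart set \<Rightarrow> 'a bilinear_field \<Rightarrow> 'a connection \<Rightarrow> bool" where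
  "codazzi A g D \<longleftrightarrow>
     (\<forall>X\<in>vector_fields A. \<forall>Y\<in>vector_fields A. \<forall>Z\<in>vector_fields A. \<forall>p.
        cov_deriv_metric g D X Y Z p = cov_deriv_metric g D Y X Z p)"

definition dual_connection ::
  "('a::topological_space, 'e::euclidean_space) chart set \<Rightarrow> 'a bilinear_field \<Rightarrow>
   'a connection \<Rightarrow> 'a connection \<Rightarrow> bool" where
  "dual_connection A g D D' \<longleftrightarrow>
     (\<forall>X\<in>vector_fields A. \<forall>Y\<in>vector_fields A. \<forall>Z\<in>vector_fields A. \<forall>p.
        X p (\<lambda>x. g x (Y x) (Z x)) = g p (D X Y p) (Z p) + g p (Y p) (D' X Z p))"

definition symmetric_bilinear_on ::
  "'v::real_vector set \<Rightarrow> ('v \<Rightarrow> 'v \<Rightarrow> real) \<Rightarrow> bool" where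
  "symmetric_bilinear_on V b \<longleftrightarrow>
     (\<forall>u\<in>V. \<forall>v\<in>V. b u v = b v u) \<and>
     (\<forall>u\<in>V. \<forall>v\<in>V. \<forall>w\<in>V. b (u + v) w = b u w + b v w) \<and>
     (\<forall>c. \<forall>u\<in>V. \<forall>w\<in>V. b (c *\<^sub>R u) w = c * b u w)"

definition nondegenerate_on :: "'v::real_vector set \<Rightarrow> ('v \<Rightarrow> 'v \<Rightarrow> real) \<Rightarrow> bool" where
  "nondegenerate_on V b \<longleftrightarrow> (\<forall>u\<in>V. (\<forall>w\<in>V. b u w = 0) \<longrightarrow> u = 0)"

definition index_on :: "'v::real_vector set \<Rightarrow> ('v \<Rightarrow> 'v \<Rightarrow> real) \<Rightarrow> nat" where
  "index_on V b = Max {dim W |W. subspace W \<and> W \<subseteq> V \<and> (\<forall>w\<in>W. w \<noteq> 0 \<longrightarrow> b w w < 0)}"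

definition semi_riemannian_metric ::
  "('a::topological_space, 'e::euclidean_space) chart set \<Rightarrow> nat \<Rightarrow> 'a bilinear_field \<Rightarrow> bool" where
  "semi_riemannian_metric A q g \<longleftrightarrow>
     (\<forall>p. symmetric_bilinear_on (tangent_space A p) (g p) \<and>
          nondegenerate_on (tangent_space A p) (g p) \<and>
          index_on (tangent_space A p) (g p) = q) \<and>
     (\<forall>X\<in>vector_fields A. \<forall>Y\<in>vector_fields A. (\<lambda>p. g p (X p) (Y p)) \<in> smooth_functions A)"

definition indefinite_statistical_manifold ::
  "('a::{t2_space,second_countable_topology}, 'e::euclidean_space) chart set \<Rightarrow> nat \<Rightarrow>
   'a bilinear_field \<Rightarrow> 'a connection \<Rightarrow> 'a connection \<Rightarrow> bool" where
  "indefinite_statistical_manifold A q g D D' \<longleftrightarrow>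
     smooth_manifold A \<and>
     1 \<le> q \<and> q \<le> DIM('e) - 1 \<and>
     semi_riemannian_metric A q g \<and>
     affine_connection A D \<and> torsion_free A D \<and> codazzi A g D \<and>
     affine_connection A D' \<and> torsion_free A D' \<and> dual_connection A g D D'"


section \<open>Lightlike submanifolds\<close>

text \<open>
  A submanifold of the manifold with atlas \<open>A\<close> is a manifold with atlas \<open>B\<close> together with
  its inclusion map \<open>i\<close>, an injective immersion; no condition relates its topology to the
  subspace topology. Tangent vectors \<open>v\<close> of the submanifold are viewed in the ambient
  tangent space as \<open>push_forward A i v\<close>.
\<close>

definition immersed_submanifold ::
  "('a::{t2_space,second_countable_topology}, 'e::euclidean_space) chart set \<Rightarrow>
   ('b::{t2_space,second_countable_topology}, 'd::euclidean_space) chart set \<Rightarrow> ('b \<Rightarrow> 'a) \<Rightarrow> bool" where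
  "immersed_submanifold A B i \<longleftrightarrow>
     smooth_manifold B \<and> smooth_map B A i \<and> inj i \<and>
     (\<forall>p. inj_on (push_forward A i) (tangent_space B p))"

definition tangent_image ::
  "('a::topological_space, 'e::euclidean_space) chart set \<Rightarrow>
   ('b::topological_space, 'd::euclidean_space) chart set \<Rightarrow> ('b \<Rightarrow> 'a) \<Rightarrow> 'b \<Rightarrow> 'a tvec set" where
  "tangent_image A B i p = push_forward A i ` tangent_space B p"

definition normal_space ::
  "('a::topological_space, 'e::euclidean_space) chart set \<Rightarrow> 'a bilinear_field \<Rightarrow>
   ('b::topological_space, 'd::euclidean_space) chart set \<Rightarrow> ('b \<Rightarrow> 'a) \<Rightarrow> 'b \<Rightarrow> 'a tvec set" where
  "normal_space A g B i p =
     {v \<in> tangent_space A (i p). \<forall>w\<in>tangent_image A B i p. g (i p) v w = 0}"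

definition Rad ::
  "('a::topological_space, 'e::euclidean_space) chart set \<Rightarrow> 'a bilinear_field \<Rightarrow>
   ('b::topological_space, 'd::euclidean_space) chart set \<Rightarrow> ('b \<Rightarrow> 'a) \<Rightarrow> 'b \<Rightarrow> 'a tvec set" where
  "Rad A g B i p = tangent_image A B i p \<inter> normal_space A g B i p"

definition induced_metric ::
  "('a::topological_space, 'e::euclidean_space) chart set \<Rightarrow> 'a bilinear_field \<Rightarrow> ('b \<Rightarrow> 'a) \<Rightarrow>
   'b bilinear_field" where
  "induced_metric A g i = (\<lambda>p v w. g (i p) (push_forward A i v) (push_forward A i w))"

text \<open>
  Smooth sections over \<open>W\<close> of the ambient tangent bundle along \<open>i\<close>, and smooth subbundles of
  that bundle, described by their fibres \<open>E p\<close>.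
\<close>

definition section_along ::
  "('a::topological_space, 'e::euclidean_space) chart set \<Rightarrow>
   ('b::topological_space, 'd::euclidean_space) chart set \<Rightarrow> ('b \<Rightarrow> 'a) \<Rightarrow>
   'b set \<Rightarrow> ('b \<Rightarrow> 'a tvec) \<Rightarrow> bool" where
  "section_along A B i W Z \<longleftrightarrow>
     (\<forall>p\<in>W. Z p \<in> tangent_space A (i p)) \<and>
     (\<forall>f\<in>smooth_functions A. smooth_fun_on B W (\<lambda>p. Z p f))"

definition local_frame ::
  "('a::topological_space, 'e::euclidean_space) chart set \<Rightarrow>
   ('b::topological_space, 'd::euclidean_space) chart set \<Rightarrow> ('b \<Rightarrow> 'a) \<Rightarrow>
   ('b \<Rightarrow> 'a tvec set) \<Rightarrow> nat \<Rightarrow> 'b set \<Rightarrow> (nat \<Rightarrow> 'b \<Rightarrow> 'a tvec) \<Rightarrow> bool" where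
  "local_frame A B i E k W e \<longleftrightarrow>
     open W \<and>
     (\<forall>j<k. section_along A B i W (e j)) \<and>
     (\<forall>p\<in>W. inj_on (\<lambda>j. e j p) {..<k} \<and>
             independent ((\<lambda>j. e j p) ` {..<k}) \<and>
             span ((\<lambda>j. e j p) ` {..<k}) = E p)"

definition smooth_subbundle ::
  "('a::topological_space, 'e::euclidean_space) chart set \<Rightarrow>
   ('b::topological_space, 'd::euclidean_space) chart set \<Rightarrow> ('b \<Rightarrow> 'a) \<Rightarrow>
   ('b \<Rightarrow> 'a tvec set) \<Rightarrow> nat \<Rightarrow> bool" where
  "smooth_subbundle A B i E k \<longleftrightarrow> (\<forall>p. \<exists>W e. p \<in> W \<and> local_frame A B i E k W e)"

definition lightlike_submanifold ::
  "('a::{t2_space,second_countable_topology}, 'e::euclidean_space) chart set \<Rightarrow> 'a bilinear_field \<Rightarrow>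
   ('b::{t2_space,second_countable_topology}, 'd::euclidean_space) chart set \<Rightarrow> ('b \<Rightarrow> 'a) \<Rightarrow>
   nat \<Rightarrow> bool" where
  "lightlike_submanifold A g B i r \<longleftrightarrow>
     immersed_submanifold A B i \<and> r > 0 \<and> smooth_subbundle A B i (Rad A g B i) r"

definition orthogonal_on :: "('v \<Rightarrow> 'v \<Rightarrow> real) \<Rightarrow> 'v set \<Rightarrow> 'v set \<Rightarrow> bool" where
  "orthogonal_on b V W \<longleftrightarrow> (\<forall>v\<in>V. \<forall>w\<in>W. b v w = 0)"

definition fibre_sum :: "'v::real_vector set \<Rightarrow> 'v set \<Rightarrow> 'v set" where
  "fibre_sum V W = {v + w |v w. v \<in> V \<and> w \<in> W}"

text \<open>\<open>E = R \<perp> S\<close> with \<open>S\<close> a non-degenerate smooth subbundle.\<close>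

definition nondegenerate_complement ::
  "('a::topological_space, 'e::euclidean_space) chart set \<Rightarrow> 'a bilinear_field \<Rightarrow>
   ('b::topological_space, 'd::euclidean_space) chart set \<Rightarrow> ('b \<Rightarrow> 'a) \<Rightarrow>
   ('b \<Rightarrow> 'a tvec set) \<Rightarrow> ('b \<Rightarrow> 'a tvec set) \<Rightarrow> ('b \<Rightarrow> 'a tvec set) \<Rightarrow> bool" where
  "nondegenerate_complement A g B i E R S \<longleftrightarrow>
     (\<exists>k. smooth_subbundle A B i S k) \<and>
     (\<forall>p. E p = fibre_sum (R p) (S p) \<and> R p \<inter> S p = {0} \<and>
          orthogonal_on (g (i p)) (R p) (S p) \<and>
          nondegenerate_on (S p) (g (i p)))"

definition screen_distribution ::
  "('a::topological_space, 'e::euclidean_space) chart set \<Rightarrow> 'a bilinear_field \<Rightarrow>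
   ('b::topological_space, 'd::euclidean_space) chart set \<Rightarrow> ('b \<Rightarrow> 'a) \<Rightarrow>
   ('b \<Rightarrow> 'a tvec set) \<Rightarrow> bool" where
  "screen_distribution A g B i S \<longleftrightarrow>
     nondegenerate_complement A g B i (tangent_image A B i) (Rad A g B i) S"

definition screen_transversal ::
  "('a::topological_space, 'e::euclidean_space) chart set \<Rightarrow> 'a bilinear_field \<Rightarrow>
   ('b::topological_space, 'd::euclidean_space) chart set \<Rightarrow> ('b \<Rightarrow> 'a) \<Rightarrow>
   ('b \<Rightarrow> 'a tvec set) \<Rightarrow> bool" where
  "screen_transversal A g B i S' \<longleftrightarrow>
     nondegenerate_complement A g B i (normal_space A g B i) (Rad A g B i) S'"

definition lightlike_transversal ::
  "('a::topological_space, 'e::euclidean_space) chart set \<Rightarrow> 'a bilinear_field \<Rightarrow>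
   ('b::topological_space, 'd::euclidean_space) chart set \<Rightarrow> ('b \<Rightarrow> 'a) \<Rightarrow> nat \<Rightarrow>
   ('b \<Rightarrow> 'a tvec set) \<Rightarrow> ('b \<Rightarrow> 'a tvec set) \<Rightarrow> ('b \<Rightarrow> 'a tvec set) \<Rightarrow> bool" where
  "lightlike_transversal A g B i r S S' L \<longleftrightarrow>
     (\<forall>p. \<exists>W \<xi> N. p \<in> W \<and>
        local_frame A B i (Rad A g B i) r W \<xi> \<and> local_frame A B i L r W N \<and>
        (\<forall>x\<in>W. \<forall>j<r. \<forall>k<r.
           g (i x) (N j x) (\<xi> k x) = (if j = k then 1 else 0) \<and>
           g (i x) (N j x) (N k x) = 0)) \<and>
     (\<forall>p. orthogonal_on (g (i p)) (L p) (S p) \<and> orthogonal_on (g (i p)) (L p) (S' p))"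

definition transversal_bundle ::
  "('b \<Rightarrow> 'a tvec set) \<Rightarrow> ('b \<Rightarrow> 'a tvec set) \<Rightarrow> 'b \<Rightarrow> 'a tvec set" where
  "transversal_bundle L S' p = fibre_sum (L p) (S' p)"

text \<open>
  The ambient derivative of \<open>Y\<close> along \<open>X\<close>, for vector fields \<open>X\<close>, \<open>Y\<close> of the
  submanifold, is computed at \<open>p\<close> from ambient vector fields that extend \<open>X\<close> and \<open>Y\<close> near
  \<open>p\<close>. Such extensions always exist and the value at \<open>p\<close> does not depend on their choice, so
  quantifying over all of them below is harmless.
\<close>

definition extends_near ::
  "('a::topological_space, 'e::euclidean_space) chart set \<Rightarrow>
   ('b::topological_space \<Rightarrow> 'a) \<Rightarrow> 'b \<Rightarrow> ('a \<Rightarrow> 'a tvec) \<Rightarrow> ('b \<Rightarrow> 'b tvec) \<Rightarrow> bool" where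
  "extends_near A i p X' X \<longleftrightarrow>
     X' \<in> vector_fields A \<and>
     (\<exists>W. open W \<and> p \<in> W \<and> (\<forall>x\<in>W. X' (i x) = push_forward A i (X x)))"

text \<open>
  \<open>D\<close> is the connection induced by the ambient connection \<open>D'\<close>: \<open>D X Y\<close> is the tangential
  component of the ambient derivative, i.e. a vector field of the submanifold that differs from
  the ambient derivative by a section of the complementary bundle \<open>T\<close>.
\<close>

definition induced_connection ::
  "('a::topological_space, 'e::euclidean_space) chart set \<Rightarrow> 'a connection \<Rightarrow>
   ('b::topological_space, 'd::euclidean_space) chart set \<Rightarrow> ('b \<Rightarrow> 'a) \<Rightarrow>
   ('b \<Rightarrow> 'a tvec set) \<Rightarrow> 'b connection \<Rightarrow> bool" where
  "induced_connection A D' B i T D \<longleftrightarrow>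
     (\<forall>X\<in>vector_fields B. \<forall>Y\<in>vector_fields B.
        D X Y \<in> vector_fields B \<and>
        (\<forall>p X' Y'. extends_near A i p X' X \<longrightarrow> extends_near A i p Y' Y \<longrightarrow>
           D' X' Y' (i p) - push_forward A i (D X Y p) \<in> T p))"

definition lightlike_statistical_submanifold ::
  "('a::{t2_space,second_countable_topology}, 'e::euclidean_space) chart set \<Rightarrow> 'a bilinear_field \<Rightarrow>
   ('b::{t2_space,second_countable_topology}, 'd::euclidean_space) chart set \<Rightarrow> ('b \<Rightarrow> 'a) \<Rightarrow>
   nat \<Rightarrow> 'b connection \<Rightarrow> bool" where
  "lightlike_statistical_submanifold A g B i r D \<longleftrightarrow>
     lightlike_submanifold A g B i r \<and> codazzi B (induced_metric A g i) D"

end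

theory Submission
  imports Defs
begin

text \<open>
  For dual connections \<open>D\<close>, \<open>D'\<close> with respect to a symmetric \<open>g\<close>, the duality identity applied to
  \<open>(Y, Z)\<close> and to \<open>(Z, Y)\<close> computes \<open>X g(Y, Z)\<close> twice. Adding the two identities gives
  \<open>D g + D' g = 0\<close>, so the Codazzi equation for \<open>D\<close> is the Codazzi equation for \<open>D'\<close> multiplied by \<open>-1\<close>
  (\<open>cov_deriv_metric_dual\<close>, \<open>codazzi_iff_dual\<close>).

  The identity \<open>D g + D' g = 0\<close> rests on the symmetry of the induced metric, which comes from that of
  the ambient metric once tangent vectors of the submanifold are known to be pushed forward to
  ambient tangent vectors. The direct reason for this is the chain rule: \<open>f \<circ> i\<close> is smooth for smooth
  \<open>f\<close>. It can also be read off from the screen decomposition \<open>TM = Rad(TM) \<perp> S(TM)\<close>, whose two summands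
  consist of ambient tangent vectors, and this is how \<open>tangent_image_subset_if_screen\<close> obtains it.
\<close>

lemma subspace_tangent_space: "subspace (tangent_space A p)"
  by (rule subspaceI)
    (auto simp: tangent_space_def scaleR_fun_def algebra_simps)

lemma smooth_subbundle_subset_tangent_space:
  assumes "smooth_subbundle A B i E k"
  shows "E p \<subseteq> tangent_space A (i p)"
proof -
  obtain W e where "p \<in> W" and e: "local_frame A B i E k W e"
    using assms unfolding smooth_subbundle_def by blast
  then have "(\<lambda>j. e j p) ` {..<k} \<subseteq> tangent_space A (i p)"
    and "span ((\<lambda>j. e j p) ` {..<k}) = E p"
    by (auto simp: local_frame_def section_along_def)
  then show ?thesis
    using span_minimal[OF _ subspace_tangent_space] by metis
qed

text \<open>
  \<open>Rad(TM)\<close> is contained in \<open>TM\<^sup>\<perp>\<close>, whose elements are ambient tangent vectors by definition, and the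
  fibres of \<open>S(TM)\<close> are spanned by frames of ambient sections.
\<close>

lemma tangent_image_subset_if_screen:
  assumes "screen_distribution A g B i S"
  shows "tangent_image A B i p \<subseteq> tangent_space A (i p)"
proof -
  have "\<exists>k. smooth_subbundle A B i S k"
    and sum: "tangent_image A B i p = fibre_sum (Rad A g B i p) (S p)"
    using assms by (simp_all add: screen_distribution_def nondegenerate_complement_def)
  then have "S p \<subseteq> tangent_space A (i p)"
    using smooth_subbundle_subset_tangent_space by metis
  moreover have "Rad A g B i p \<subseteq> tangent_space A (i p)"
    by (auto simp: Rad_def normal_space_def)
  ultimately show ?thesis
    by (auto simp: sum fibre_sum_def intro!: subspace_add[OF subspace_tangent_space])
qed

lemma induced_metric_sym:
  assumes "symmetric_bilinear_on (tangent_space A (i p)) (g (i p))"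
    and "tangent_image A B i p \<subseteq> tangent_space A (i p)"
    and "u \<in> tangent_space B p" and "v \<in> tangent_space B p"
  shows "induced_metric A g i p u v = induced_metric A g i p v u"
  using assms
  by (simp add: symmetric_bilinear_on_def tangent_image_def induced_metric_def image_subset_iff)

text \<open>
  In \<open>D g + D' g\<close> the two terms \<open>X g(Y, Z)\<close> cancel, one against \<open>g(D\<^sub>X Y, Z) + g(Y, D'\<^sub>X Z)\<close> and the other,
  rewritten as \<open>X g(Z, Y)\<close>, against \<open>g(D\<^sub>X Z, Y) + g(Z, D'\<^sub>X Y)\<close>.
\<close>

lemma cov_deriv_metric_dual:
  assumes dual: "dual_connection B g D D'"
    and sym: "\<And>p u v. u \<in> tangent_space B p \<Longrightarrow> v \<in> tangent_space B p \<Longrightarrow> g p u v = g p v u"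
    and closed: "D X Z \<in> vector_fields B" "D' X Y \<in> vector_fields B"
    and fields: "X \<in> vector_fields B" "Y \<in> vector_fields B" "Z \<in> vector_fields B"
  shows "cov_deriv_metric g D X Y Z p = - cov_deriv_metric g D' X Y Z p"
proof -
  have sym_fields: "g x (U x) (V x) = g x (V x) (U x)"
    if "U \<in> vector_fields B" "V \<in> vector_fields B" for U V x
    using sym that unfolding vector_fields_def by blast
  have "X p (\<lambda>x. g x (Y x) (Z x)) = g p (D X Y p) (Z p) + g p (Y p) (D' X Z p)"
    using dual fields unfolding dual_connection_def by blast
  moreover have "X p (\<lambda>x. g x (Z x) (Y x)) = g p (D X Z p) (Y p) + g p (Z p) (D' X Y p)"
    using dual fields unfolding dual_connection_def by blast
  moreover have "(\<lambda>x. g x (Z x) (Y x)) = (\<lambda>x. g x (Y x) (Z x))"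
    using sym_fields fields by blast
  ultimately show ?thesis
    using sym_fields[OF closed(1) fields(2), of p] sym_fields[OF closed(2) fields(3), of p]
    by (simp add: cov_deriv_metric_def)
qed

lemma codazzi_iff_dual:
  assumes "dual_connection B g D D'"
    and "\<And>p u v. u \<in> tangent_space B p \<Longrightarrow> v \<in> tangent_space B p \<Longrightarrow> g p u v = g p v u"
    and "\<And>X Y. X \<in> vector_fields B \<Longrightarrow> Y \<in> vector_fields B \<Longrightarrow> D X Y \<in> vector_fields B"
    and "\<And>X Y. X \<in> vector_fields B \<Longrightarrow> Y \<in> vector_fields B \<Longrightarrow> D' X Y \<in> vector_fields B"
  shows "codazzi B g D \<longleftrightarrow> codazzi B g D'"
proof -
  have "cov_deriv_metric g D X Y Z p = - cov_deriv_metric g D' X Y Z p"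
    if "X \<in> vector_fields B" "Y \<in> vector_fields B" "Z \<in> vector_fields B" for X Y Z p
    by (rule cov_deriv_metric_dual[OF assms(1,2)]) (use assms(3,4) that in blast)+
  then show ?thesis
    by (simp add: codazzi_def)
qed

theorem theorem3p6:
  fixes m n q r :: nat
    and Mbar :: "('a::{t2_space,second_countable_topology}, 'e::euclidean_space) chart set"
    and gbar :: "'a bilinear_field"
    and Dbar Dbar' :: "'a connection"
    and M :: "('b::{t2_space,second_countable_topology}, 'd::euclidean_space) chart set"
    and i :: "'b \<Rightarrow> 'a"
    and S S' L :: "'b \<Rightarrow> 'a tvec set"
    and D D' :: "'b connection"
  assumes "m \<ge> 1" and "n \<ge> 1" and "DIM('e) = m + n" and "DIM('d) = m"
    and "indefinite_statistical_manifold Mbar q gbar Dbar Dbar'"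
    and "lightlike_submanifold Mbar gbar M i r"
    and "screen_distribution Mbar gbar M i S"
    and "screen_transversal Mbar gbar M i S'"
    and "lightlike_transversal Mbar gbar M i r S S' L"
    and "induced_connection Mbar Dbar M i (transversal_bundle L S') D"
    and "induced_connection Mbar Dbar' M i (transversal_bundle L S') D'"
    and "dual_connection M (induced_metric Mbar gbar i) D D'"
  shows "lightlike_statistical_submanifold Mbar gbar M i r D \<longleftrightarrow>
         lightlike_statistical_submanifold Mbar gbar M i r D'"
proof -
  have "induced_metric Mbar gbar i p u v = induced_metric Mbar gbar i p v u"
    if "u \<in> tangent_space M p" "v \<in> tangent_space M p" for p u v
  proof (rule induced_metric_sym[OF _ _ that])
    show "symmetric_bilinear_on (tangent_space Mbar (i p)) (gbar (i p))"
      using assms(5)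
      unfolding indefinite_statistical_manifold_def semi_riemannian_metric_def by blast
    show "tangent_image Mbar M i p \<subseteq> tangent_space Mbar (i p)"
      using assms(7) by (rule tangent_image_subset_if_screen)
  qed
  moreover have "D X Y \<in> vector_fields M" "D' X Y \<in> vector_fields M"
    if "X \<in> vector_fields M" "Y \<in> vector_fields M" for X Y
    using assms(10,11) that unfolding induced_connection_def by blast+
  ultimately have "codazzi M (induced_metric Mbar gbar i) D \<longleftrightarrow>
      codazzi M (induced_metric Mbar gbar i) D'"
    using assms(12) by (intro codazzi_iff_dual)
  then show ?thesis
    by (simp add: lightlike_statistical_submanifold_def)
qed

end
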